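(* Let $\alpha,\beta,\gamma,\delta,\epsilon,q,t\in\mathbb{C}$ with $\gamma+\delta+\epsilon=\alpha+\beta+1$ and $t\ne 0,1$, and consider Heun's differential equation $$\frac{d^2y}{dz^2}+\left(\frac{\gamma}{z}+\frac{\delta}{z-1}+\frac{\epsilon}{z-t}\right)\frac{dy}{dz}+\frac{\alpha\beta z-q}{z(z-1)(z-t)}\,y=0. \qquad (\ast)$$ Assume that $\epsilon\in\mathbb{Z}_{\le 0}$, $\alpha\in\mathbb{Z}_{\le 0}$ and $\beta\notin\mathbb{Z}_{\le 0}$. (i) If $-\alpha\le-\epsilon$ and $(\ast)$ has a non-zero polynomial solution, then the singularity $z=t$ of $(\ast)$ is apparent. (ii) If $-\epsilon\le-\alpha$ and the singularity $z=t$ of $(\ast)$ is apparent, then $(\ast)$ has a non-zero polynomial solution.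
   Context: For $\epsilon\in\mathbb{Z}_{\le 0}$ the point $z=t$ has exponents $0$ and $1-\epsilon$, and $(\ast)$ has a basis of local solutions around $z=t$ of the form $g(z)=(z-t)^{1-\epsilon}\sum_{j\ge0}\tilde c_j(z-t)^j$ with $\tilde c_0\neq0$, and $f(z)=\sum_{j\ge0}c_j(z-t)^j+A\,g(z)\log(z-t)$ with $c_0\ne0$. The singularity $z=t$ is called apparent if $A=0$, i.e. if there is no logarithmic term; equivalently, the monodromy of $(\ast)$ around $z=t$ is trivial. *)

theory Defs
  imports "HOL-Complex_Analysis.Complex_Analysis"
begin

text \<open>The equation is meaningful for open \<open>S\<close> that avoids \<open>0\<close>, \<open>1\<close>, \<open>t\<close>.\<close>

definition heun_solution_on ::
    "complex \<Rightarrow> complex \<Rightarrow> complex \<Rightarrow> complex \<Rightarrow> complex \<Rightarrow> complex \<Rightarrow> complex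
      \<Rightarrow> complex set \<Rightarrow> (complex \<Rightarrow> complex) \<Rightarrow> bool"
  where "heun_solution_on \<alpha> \<beta> \<gamma> \<delta> \<epsilon> q t S y \<longleftrightarrow>
    y holomorphic_on S \<and>
    (\<forall>z\<in>S. (deriv ^^ 2) y z
        + (\<gamma> / z + \<delta> / (z - 1) + \<epsilon> / (z - t)) * deriv y z
        + (\<alpha> * \<beta> * z - q) / (z * (z - 1) * (z - t)) * y z = 0)"

definition heun_has_poly_solution ::
    "complex \<Rightarrow> complex \<Rightarrow> complex \<Rightarrow> complex \<Rightarrow> complex \<Rightarrow> complex \<Rightarrow> complex \<Rightarrow> bool"
  where "heun_has_poly_solution \<alpha> \<beta> \<gamma> \<delta> \<epsilon> q t \<longleftrightarrow>
    (\<exists>p :: complex poly. p \<noteq> 0 \<and> heun_solution_on \<alpha> \<beta> \<gamma> \<delta> \<epsilon> q t (- {0, 1, t}) (poly p))"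

definition slit_disc :: "complex \<Rightarrow> real \<Rightarrow> complex set"
  where "slit_disc t r = {z \<in> ball t r. z - t \<notin> \<real>\<^sub>\<le>\<^sub>0}"

text \<open>
  The logarithm in \<open>f\<close> is the principal one, hence the slit disc. Since \<open>\<epsilon>\<close> is an integer,
  \<open>(z - t) powr (1 - \<epsilon>)\<close> is an
  integer power and does not depend on a branch. That \<open>f\<close> and \<open>g\<close> are linearly independent, and
  hence a basis of the two-dimensional space of solutions, follows from the non-vanishing of the
  constant coefficients.
\<close>

definition heun_local_basis ::
    "complex \<Rightarrow> complex \<Rightarrow> complex \<Rightarrow> complex \<Rightarrow> complex \<Rightarrow> complex \<Rightarrow> complex
      \<Rightarrow> complex fps \<Rightarrow> complex fps \<Rightarrow> complex \<Rightarrow> bool"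
  where "heun_local_basis \<alpha> \<beta> \<gamma> \<delta> \<epsilon> q t F G A \<longleftrightarrow>
    fps_nth F 0 \<noteq> 0 \<and> fps_nth G 0 \<noteq> 0 \<and>
    (\<exists>r>0. ereal r \<le> fps_conv_radius F \<and> ereal r \<le> fps_conv_radius G \<and>
       0 \<notin> ball t r \<and> 1 \<notin> ball t r \<and>
       (let g = (\<lambda>z. (z - t) powr (1 - \<epsilon>) * eval_fps G (z - t));
            f = (\<lambda>z. eval_fps F (z - t) + A * g z * Ln (z - t))
        in heun_solution_on \<alpha> \<beta> \<gamma> \<delta> \<epsilon> q t (slit_disc t r) g \<and>
           heun_solution_on \<alpha> \<beta> \<gamma> \<delta> \<epsilon> q t (slit_disc t r) f))"

text \<open>
  For \<open>\<epsilon> \<in> \<int>\<^sub>\<le>\<^sub>0\<close>. In a local basis \<open>g\<close> is unique up to a non-zero factor, and \<open>f\<close> up to a non-zero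
  factor and the addition of a multiple of \<open>g\<close>, so whether \<open>A\<close> vanishes does not depend on the
  choice of the basis.
\<close>

definition heun_apparent ::
    "complex \<Rightarrow> complex \<Rightarrow> complex \<Rightarrow> complex \<Rightarrow> complex \<Rightarrow> complex \<Rightarrow> complex \<Rightarrow> bool"
  where "heun_apparent \<alpha> \<beta> \<gamma> \<delta> \<epsilon> q t \<longleftrightarrow>
    (\<exists>F G A. heun_local_basis \<alpha> \<beta> \<gamma> \<delta> \<epsilon> q t F G A \<and> A = 0)"

end

theory Submission
  imports Defs
begin

text \<open>
  Put \<open>w = z - t\<close>, \<open>\<epsilon> = -m\<close>, \<open>\<alpha> = -n\<close>, and multiply the equation by \<open>z (z - 1) (z - t)\<close>. On a power
  series \<open>\<Sum>k. c\<^sub>k w^k\<close> it becomes a three-term recurrence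
  \<open>up k * c (k+1) + diag k * c k + down (k-1) * c (k-1) = 0\<close>. Its two outer coefficients carry all the
  information: \<open>up k = t (t - 1) (k + 1) (k - m)\<close> vanishes only at \<open>k = m\<close>, which reflects the exponents
  \<open>0\<close> and \<open>m + 1\<close> at \<open>t\<close>, and \<open>down k = (k + \<alpha>) (k + \<beta>)\<close> vanishes only at \<open>k = n\<close>, which reflects the
  exponents \<open>\<alpha>\<close> and \<open>\<beta>\<close> at infinity. Here the Fuchs relation and \<open>\<beta> \<notin> \<int>\<^sub>\<le>\<^sub>0\<close> enter. The singularity \<open>t\<close> is
  apparent when a convergent power series with \<open>c\<^sub>0 \<noteq> 0\<close> solves the recurrence.

  The solution \<open>g\<close> with exponent \<open>m + 1\<close> always exists: above index \<open>m\<close> the recurrence determines its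
  coefficients, and they grow at most geometrically since \<open>diag k / up k\<close> and \<open>down (k-1) / up k\<close> are
  bounded (\<open>frobenius_solution\<close>).

  (i) A polynomial solution has degree exactly \<open>n\<close>, because \<open>down\<close> must vanish at its degree
  (\<open>degree_poly_kernel\<close>). If \<open>c\<^sub>0\<close> were \<open>0\<close>, the recurrence would force \<open>c\<^sub>k = 0\<close> for all \<open>k \<le> m\<close>
  (\<open>heun_op_vanishing\<close>), hence up to the degree when \<open>n \<le> m\<close>. So \<open>c\<^sub>0 \<noteq> 0\<close>, and the polynomial serves as
  the solution \<open>f\<close> without logarithm.

  (ii) When \<open>m \<le> n\<close>, any power series solution with \<open>c (n+1) = 0\<close> is a polynomial, since \<open>down n = 0\<close> cuts
  the recurrence off (\<open>heun_op_termination\<close>). If \<open>t\<close> is apparent there are two independent power series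
  solutions, so some non-trivial combination of them has \<open>c (n+1) = 0\<close>.

  The rest is the dictionary between functions on the slit disc and formal power series: a power series
  solves the equation on the slit disc exactly if the differential operator kills it formally.
\<close>

section \<open>Convergence of three-term recurrences\<close>

fun three_term :: "(nat \<Rightarrow> complex) \<Rightarrow> (nat \<Rightarrow> complex) \<Rightarrow> nat \<Rightarrow> complex"
  where
    "three_term p r 0 = 1"
  | "three_term p r (Suc 0) = p 0"
  | "three_term p r (Suc (Suc k)) = p (Suc k) * three_term p r (Suc k) + r k * three_term p r k"

text \<open>
  The ratio \<open>1 + M\<close> works because \<open>x = 1 + M\<close> satisfies \<open>M x + M \<le> x\<^sup>2\<close>.
\<close>

lemma three_term_norm_le:
  assumes p: "\<And>k. norm (p k) \<le> M" and r: "\<And>k. norm (r k) \<le> M"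
  shows "norm (three_term p r k) \<le> (1 + M) ^ k"
proof (induction k rule: less_induct)
  case (less k)
  have M: "0 \<le> M"
    using p[of 0] norm_ge_zero order_trans by blast
  consider "k = 0" | "k = Suc 0" | j where "k = Suc (Suc j)"
    by (metis old.nat.exhaust)
  then show ?case
  proof cases
    case (3 j)
    have "norm (three_term p r k) \<le> M * (1 + M) ^ Suc j + M * (1 + M) ^ j"
      unfolding 3 three_term.simps
      using less.IH[of "Suc j"] less.IH[of j] 3 p r M
      by (intro order_trans[OF norm_triangle_ineq] add_mono) (auto simp: norm_mult simp del: power_Suc intro!: mult_mono)
    also have "\<dots> \<le> (1 + M) ^ j * (1 + M)\<^sup>2"
    proof -
      have "M * (1 + M) + M \<le> (1 + M)\<^sup>2" by (simp add: power2_eq_square algebra_simps)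
      from mult_left_mono[OF this, of "(1 + M) ^ j"] show ?thesis
        using M by (simp add: algebra_simps)
    qed
    finally show ?thesis by (simp add: 3 power2_eq_square mult_ac)
  qed (use M p[of 0] in auto)
qed

lemma three_term_conv_radius_pos:
  assumes p: "\<And>k. norm (p k) \<le> M" and r: "\<And>k. norm (r k) \<le> M"
  shows "fps_conv_radius (Abs_fps (three_term p r)) > 0"
proof -
  have M: "0 \<le> M"
    using p[of 0] norm_ge_zero order_trans by blast
  \<comment> \<open>At half the reciprocal of the growth rate, the terms are dominated by a geometric series.\<close>
  define x where "x = 1 / (2 * (1 + M))"
  have x: "x > 0" "(1 + M) * x = 1 / 2"
    using M by (auto simp: x_def field_simps)
  have "summable (\<lambda>k. three_term p r k * of_real x ^ k)"
  proof (rule summable_comparison_test)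
    show "\<exists>N. \<forall>k\<ge>N. norm (three_term p r k * of_real x ^ k) \<le> (1 / 2) ^ k"
    proof (intro exI allI impI)
      fix k
      have "norm (three_term p r k * of_real x ^ k) \<le> (1 + M) ^ k * x ^ k"
        unfolding norm_mult norm_power using x M three_term_norm_le[where p = p and r = r, OF p r]
        by (intro mult_mono) auto
      also have "\<dots> = (1 / 2) ^ k"
        by (simp only: power_mult_distrib[symmetric] x)
      finally show "norm (three_term p r k * of_real x ^ k) \<le> (1 / 2) ^ k" .
    qed
  qed (auto intro: summable_geometric)
  from conv_radius_geI[OF this] x(1) show ?thesis
    by (auto simp: fps_conv_radius_def intro: less_le_trans[rotated])
qed

lemma norm_quadratic_le:
  fixes u v w :: complex
  shows "norm (u * of_nat k * of_nat k + v * of_nat k + w)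
           \<le> (norm u + norm v + norm w) * (real k + 1)\<^sup>2"
proof -
  have "norm (u * of_nat k * of_nat k + v * of_nat k + w)
          \<le> norm u * (real k * real k) + norm v * real k + norm w"
    by (intro order_trans[OF norm_triangle_ineq] add_mono) (auto simp: norm_mult)
  also have "\<dots> \<le> norm u * (real k + 1)\<^sup>2 + norm v * (real k + 1)\<^sup>2 + norm w * (real k + 1)\<^sup>2"
  proof (intro add_mono mult_left_mono)
    show "norm w \<le> norm w * (real k + 1)\<^sup>2"
      by (rule mult_left_mono[of 1 _ "norm w", simplified]) (auto simp: power2_eq_square algebra_simps)
  qed (auto simp: power2_eq_square algebra_simps)
  finally show ?thesis by (simp add: algebra_simps)
qed


section \<open>Heun's operator on power series at the singularity \<open>t\<close>\<close>

locale heun =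
  fixes \<alpha> \<beta> \<gamma> \<delta> \<epsilon> q t :: complex and m :: nat
  assumes fuchs: "\<gamma> + \<delta> + \<epsilon> = \<alpha> + \<beta> + 1"
    and t0: "t \<noteq> 0" and t1: "t \<noteq> 1"
    and eps: "\<epsilon> = - of_nat m"
begin

text \<open>
  The left-hand side of the equation multiplied by \<open>z (z - 1) (z - t)\<close>, with coefficients expanded in
  powers of \<open>w = z - t\<close>. The formal operator makes sense without any convergence.
\<close>

definition heun_op :: "complex fps \<Rightarrow> complex fps"
  where "heun_op C =
     fps_of_poly [:0, t * (t - 1), 2 * t - 1, 1:] * fps_deriv (fps_deriv C)
   + fps_of_poly [:\<epsilon> * t * (t - 1), \<gamma> * (t - 1) + \<delta> * t + \<epsilon> * (2 * t - 1), \<gamma> + \<delta> + \<epsilon>:] * fps_deriv C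
   + fps_of_poly [:\<alpha> * \<beta> * t - q, \<alpha> * \<beta>:] * C"

text \<open>
  The contributions of \<open>c (k+1)\<close> and \<open>c k\<close> to the coefficient of \<open>w^k\<close>, and that of \<open>c k\<close> to the
  coefficient of \<open>w^(k+1)\<close>.
\<close>

definition up :: "nat \<Rightarrow> complex"
  where "up k = t * (t - 1) * of_nat (k + 1) * (of_nat k + \<epsilon>)"

definition diag :: "nat \<Rightarrow> complex"
  where "diag k = (2 * t - 1) * of_nat k * (of_nat k - 1)
     + (\<gamma> * (t - 1) + \<delta> * t + \<epsilon> * (2 * t - 1)) * of_nat k + (\<alpha> * \<beta> * t - q)"

definition down :: "nat \<Rightarrow> complex"
  where "down k = (of_nat k + \<alpha>) * (of_nat k + \<beta>)"

text \<open>
  Horner's scheme turns multiplication by a polynomial into coefficient shifts.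
\<close>

lemma fps_of_poly_pCons_mult:
  "fps_of_poly (pCons (c :: complex) p) * D = fps_const c * D + fps_X * (fps_of_poly p * D)"
  by (simp add: fps_of_poly_pCons algebra_simps)

lemma heun_op_nth_0: "fps_nth (heun_op C) 0 = up 0 * fps_nth C 1 + diag 0 * fps_nth C 0"
  by (simp add: heun_op_def up_def diag_def fps_of_poly_pCons_mult algebra_simps)

lemma heun_op_nth_Suc:
  "fps_nth (heun_op C) (Suc k) =
     up (Suc k) * fps_nth C (k + 2) + diag (Suc k) * fps_nth C (Suc k) + down k * fps_nth C k"
proof -
  \<comment> \<open>The Fuchs relation is what factors this quadratic.\<close>
  have *: "down k = of_nat k * (of_nat k - 1) + (\<gamma> + \<delta> + \<epsilon>) * of_nat k + \<alpha> * \<beta>"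
    unfolding down_def fuchs by (simp add: algebra_simps)
  consider "k = 0" | "k = 1" | j where "k = Suc (Suc j)"
    by (metis One_nat_def old.nat.exhaust)
  then show ?thesis
    unfolding * heun_op_def up_def diag_def fps_of_poly_pCons_mult
    by cases (simp_all, simp_all add: algebra_simps)
qed

lemma heun_op_eq_0_iff:
  "heun_op C = 0 \<longleftrightarrow>
     up 0 * fps_nth C 1 + diag 0 * fps_nth C 0 = 0 \<and>
     (\<forall>k. up (Suc k) * fps_nth C (k + 2) + diag (Suc k) * fps_nth C (Suc k)
          + down k * fps_nth C k = 0)"
  unfolding fps_eq_iff fps_zero_nth by (metis heun_op_nth_0 heun_op_nth_Suc not0_implies_Suc)

lemma heun_op_linear: "heun_op (F + fps_const c * G) = heun_op F + fps_const c * heun_op G"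
  by (simp add: heun_op_def algebra_simps)

lemma up_altdef: "up k = t * (t - 1) * of_nat (k + 1) * (of_nat k - of_nat m)"
  unfolding up_def by (simp add: eps)

lemma up_eq_0_iff: "up k = 0 \<longleftrightarrow> k = m"
  using t0 t1 by (simp add: up_altdef del: of_nat_add of_nat_Suc)

text \<open>
  Up to index \<open>m\<close> each coefficient after \<open>c\<^sub>0\<close> is determined by its predecessors, as one can divide by \<open>up\<close>.
\<close>

lemma heun_op_vanishing:
  assumes "heun_op C = 0" "fps_nth C 0 = 0" "k \<le> m"
  shows "fps_nth C k = 0"
  using assms(3)
proof (induction k rule: less_induct)
  case (less k)
  consider "k = 0" | "k = 1" | j where "k = j + 2"
    by (metis One_nat_def Suc_1 add_2_eq_Suc' not0_implies_Suc)
  then show ?case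
  proof cases
    case 2
    then show ?thesis using assms(1,2) less.prems up_eq_0_iff[of 0] by (auto simp: heun_op_eq_0_iff)
  next
    case (3 j)
    have "fps_nth C (Suc j) = 0" "fps_nth C j = 0"
      using less 3 by auto
    moreover have "up (Suc j) \<noteq> 0" using less.prems 3 by (simp add: up_eq_0_iff)
    moreover have "up (Suc j) * fps_nth C (j + 2) + diag (Suc j) * fps_nth C (Suc j)
          + down j * fps_nth C j = 0"
      using assms(1) by (auto simp: heun_op_eq_0_iff)
    ultimately show ?thesis using 3 by simp
  qed (use assms in auto)
qed

text \<open>
  The vanishing of \<open>down n\<close> decouples the coefficients above \<open>n\<close> from \<open>c\<^sub>n\<close>. They are then all
  determined by \<open>c (n+1)\<close>, because \<open>m \<le> n\<close> keeps \<open>up\<close> from vanishing at the indices above \<open>n\<close>.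
\<close>

lemma heun_op_termination:
  assumes "heun_op C = 0" "\<alpha> = - of_nat n" "m \<le> n" "fps_nth C (Suc n) = 0" "n < k"
  shows "fps_nth C k = 0"
  using \<open>n < k\<close>
proof (induction k rule: less_induct)
  have down_n: "down n = 0" unfolding down_def by (subst assms(2)) simp
  case (less k)
  show ?case
  proof (cases "k = Suc n")
    case False
    then obtain j where j: "k = j + 2" "n \<le> j"
      using less.prems that[of "k - 2"] by simp
    have "fps_nth C (Suc j) = 0" using less.IH[of "Suc j"] j by simp
    moreover have "down j * fps_nth C j = 0"
      using less.IH[of j] j down_n by (cases "j = n") auto
    moreover have "up (Suc j) \<noteq> 0" using j assms(3) by (simp add: up_eq_0_iff)
    moreover have "up (Suc j) * fps_nth C (j + 2) + diag (Suc j) * fps_nth C (Suc j)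
          + down j * fps_nth C j = 0"
      using assms(1) by (auto simp: heun_op_eq_0_iff)
    ultimately show ?thesis using j by auto
  qed (use assms in auto)
qed

text \<open>
  At one above the degree only the \<open>down\<close> term of the recurrence is left.
\<close>

lemma degree_poly_kernel:
  assumes "heun_op (fps_of_poly p) = 0" "p \<noteq> 0" "\<alpha> = - of_nat n" "\<beta> \<notin> \<int>\<^sub>\<le>\<^sub>0"
  shows "degree p = n"
proof -
  let ?d = "degree p"
  have "down ?d * coeff p ?d = 0"
    using assms(1) by (auto simp: heun_op_eq_0_iff coeff_eq_0 dest!: conjunct2 spec[of _ ?d])
  then have "down ?d = 0" using assms(2) by simp
  moreover have "of_nat ?d + \<beta> \<noteq> 0"
    using assms(4) by (metis add.commute add_eq_0_iff minus_of_nat_in_nonpos_Ints)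
  ultimately have "of_nat ?d + \<alpha> = 0" unfolding down_def by simp
  then show ?thesis by (simp add: assms(3))
qed

text \<open>
  Above \<open>m\<close> the factor \<open>k - m\<close> of \<open>up k\<close> is at least \<open>(k + 1) / (m + 2)\<close>, so \<open>up\<close> grows quadratically.
  Hence it dominates \<open>diag\<close> and \<open>down\<close>, which are quadratic in the index.
\<close>

lemma norm_up_ge:
  assumes "m < k"
  shows "norm (t * (t - 1)) * (real k + 1)\<^sup>2 \<le> (real m + 2) * norm (up k)"
proof -
  obtain j where k: "k = m + Suc j" using assms less_imp_add_positive
    by (metis add_Suc_right less_imp_Suc_add)
  have "of_nat k - of_nat m = (of_nat (Suc j) :: complex)" by (simp add: k)
  then have "norm (up k) = norm (t * (t - 1)) * (real k + 1) * (real j + 1)"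
    unfolding up_altdef norm_mult by (simp only: norm_of_nat) (simp add: algebra_simps)
  moreover have "real k + 1 \<le> (real m + 2) * (real j + 1)"
    by (simp add: k algebra_simps)
  then have "norm (t * (t - 1)) * (real k + 1) * (real k + 1)
     \<le> norm (t * (t - 1)) * (real k + 1) * ((real m + 2) * (real j + 1))"
    by (intro mult_left_mono) auto
  ultimately show ?thesis by (simp add: power2_eq_square mult_ac)
qed

lemma quadratic_over_up_bounded:
  "\<exists>M. \<forall>k>m. \<forall>i\<le>k. norm ((u * of_nat i * of_nat i + v * of_nat i + w) / up k) \<le> M"
proof (intro exI allI impI)
  fix k i assume k: "m < k" "i \<le> k"
  let ?D = "norm u + norm v + norm w" and ?T = "norm (t * (t - 1))"
  have T: "?T > 0" using t0 t1 by simp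
  have up: "norm (up k) > 0" using k by (simp add: up_eq_0_iff)
  have "norm (u * of_nat i * of_nat i + v * of_nat i + w) \<le> ?D * (real i + 1)\<^sup>2"
    by (rule norm_quadratic_le)
  also have "\<dots> \<le> ?D * (real k + 1)\<^sup>2"
    using k by (intro mult_left_mono power_mono) auto
  also have "\<dots> \<le> ?D * ((real m + 2) / ?T * norm (up k))"
    using norm_up_ge[OF k(1)] T by (intro mult_left_mono) (auto simp: field_simps)
  finally show "norm ((u * of_nat i * of_nat i + v * of_nat i + w) / up k)
                  \<le> ?D * ((real m + 2) / ?T)"
    using up by (simp add: norm_divide divide_le_eq mult_ac)
qed

text \<open>
  The local solution with the larger exponent \<open>m + 1\<close>. As \<open>up m = 0\<close>, the coefficient at \<open>m + 1\<close> is free and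
  starts a recurrence that can be solved for all later coefficients.
\<close>

lemma frobenius_solution:
  obtains G where "fps_nth G 0 = 1" "fps_conv_radius G > 0" "heun_op (fps_X ^ (m + 1) * G) = 0"
proof -
  define p where "p j = - diag (m + 1 + j) / up (m + 1 + j)" for j
  define r where "r j = - down (m + 1 + j) / up (m + 2 + j)" for j
  have diag: "diag k = (2 * t - 1) * of_nat k * of_nat k
     + (\<gamma> * (t - 1) + \<delta> * t + \<epsilon> * (2 * t - 1) - (2 * t - 1)) * of_nat k + (\<alpha> * \<beta> * t - q)" for k
    by (simp add: diag_def algebra_simps)
  have down: "down k = 1 * of_nat k * of_nat k + (\<alpha> + \<beta>) * of_nat k + \<alpha> * \<beta>" for k
    by (simp add: down_def algebra_simps)
  obtain M1 where M1: "\<forall>k>m. \<forall>i\<le>k. norm (diag i / up k) \<le> M1"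
    unfolding diag using quadratic_over_up_bounded by blast
  obtain M2 where M2: "\<forall>k>m. \<forall>i\<le>k. norm (down i / up k) \<le> M2"
    unfolding down using quadratic_over_up_bounded by blast
  define G where "G = Abs_fps (three_term p r)"
  let ?C = "fps_X ^ (m + 1) * G"
  have "fps_conv_radius G > 0"
    unfolding G_def
  proof (rule three_term_conv_radius_pos)
    show "norm (p j) \<le> max M1 M2" for j
      using M1[rule_format, of "m + 1 + j" "m + 1 + j"] by (simp add: p_def norm_divide)
    show "norm (r j) \<le> max M1 M2" for j
      using M2[rule_format, of "m + 2 + j" "m + 1 + j"] by (simp add: r_def norm_divide)
  qed
  moreover have "heun_op ?C = 0"
  proof -
    have low: "fps_nth ?C k = 0" if "k \<le> m" for k
      using that by (simp only: fps_X_power_mult_nth) simp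
    have high: "fps_nth ?C (m + 1 + j) = three_term p r j" for j
      by (simp only: fps_X_power_mult_nth) (simp add: G_def)
    have "up 0 * fps_nth ?C 1 + diag 0 * fps_nth ?C 0 = 0"
      using low[of 0] low[of 1] up_eq_0_iff[of 0] by (cases "m = 0") auto
    moreover have "up (Suc k) * fps_nth ?C (k + 2) + diag (Suc k) * fps_nth ?C (Suc k)
          + down k * fps_nth ?C k = 0" for k
    proof -
      consider "k + 2 \<le> m" | "Suc k = m" | "k = m" | j where "k = m + 1 + j"
        by (metis One_nat_def Suc_eq_plus1 Suc_leI add_2_eq_Suc' le_Suc_ex linorder_neqE_nat le_neq_implies_less)
      then show ?thesis
      proof cases
        case 1
        then show ?thesis using low[of k] low[of "k + 1"] low[of "k + 2"] by simp
      next
        case 2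
        then show ?thesis using low[of k] low[of "k + 1"] by (simp add: up_eq_0_iff)
      next
        case 3
        then show ?thesis
          using low[of m] high[of 0] high[of 1] up_eq_0_iff[of "m + 1"]
          by (simp add: p_def)
      next
        case (4 j)
        have "up (m + 2 + j) \<noteq> 0" by (simp add: up_eq_0_iff)
        then have pr: "up (m + 2 + j) * p (Suc j) = - diag (m + 2 + j)"
            "up (m + 2 + j) * r j = - down (m + 1 + j)"
          by (simp_all add: p_def r_def)
        have "up (m + 2 + j) * three_term p r (Suc (Suc j)) =
            (up (m + 2 + j) * p (Suc j)) * three_term p r (Suc j)
            + (up (m + 2 + j) * r j) * three_term p r j"
          by (simp add: algebra_simps)
        then have "up (m + 2 + j) * fps_nth ?C (m + 1 + (j + 2))
            + diag (m + 2 + j) * fps_nth ?C (m + 1 + (j + 1))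
            + down (m + 1 + j) * fps_nth ?C (m + 1 + j) = 0"
          unfolding high pr by (simp add: algebra_simps)
        moreover have "m + 2 + j = Suc k" "m + 1 + (j + 2) = k + 2" "m + 1 + (j + 1) = Suc k"
          "m + 1 + j = k"
          using 4 by simp_all
        ultimately show ?thesis by (simp only:)
      qed
    qed
    ultimately show ?thesis by (auto simp: heun_op_eq_0_iff)
  qed
  moreover have "fps_nth G 0 = 1" by (simp add: G_def)
  ultimately show ?thesis using that by blast
qed


section \<open>From power series to solutions\<close>

lemma deriv_eval_fps_shift:
  assumes "ereal (norm (z - t)) < fps_conv_radius C"
  shows "((\<lambda>z. eval_fps C (z - t)) has_field_derivative eval_fps (fps_deriv C) (z - t)) (at z)"
proof -
  have "((eval_fps C \<circ> (\<lambda>z. z - t)) has_field_derivative eval_fps (fps_deriv C) (z - t) * 1) (at z)"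
    by (intro DERIV_chain has_field_derivative_eval_fps assms) (auto intro!: derivative_eq_intros)
  then show ?thesis by (simp add: o_def)
qed

lemma conv_radius_heun_op: "fps_conv_radius C \<le> fps_conv_radius (heun_op C)"
proof -
  let ?R = "fps_conv_radius C"
  have d1: "?R \<le> fps_conv_radius (fps_deriv C)" by (rule fps_conv_radius_deriv)
  have d2: "?R \<le> fps_conv_radius (fps_deriv (fps_deriv C))"
    using d1 fps_conv_radius_deriv order_trans by blast
  have mult: "?R \<le> fps_conv_radius (fps_of_poly p * D)" if "?R \<le> fps_conv_radius D" for p D
    using fps_conv_radius_mult[of "fps_of_poly p" D] that by simp
  have add: "?R \<le> fps_conv_radius (D + E)" if "?R \<le> fps_conv_radius D" "?R \<le> fps_conv_radius E" for D E
    using fps_conv_radius_add[of D E] that by (meson min.boundedI order_trans)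
  show ?thesis unfolding heun_op_def by (intro add mult d1 d2 order_refl)
qed

lemma eval_heun_op:
  assumes "ereal (norm w) < fps_conv_radius C"
  shows "eval_fps (heun_op C) w =
     w * (w + t) * (w + t - 1) * eval_fps (fps_deriv (fps_deriv C)) w
     + (\<gamma> * w * (w + t - 1) + \<delta> * w * (w + t) + \<epsilon> * (w + t) * (w + t - 1)) * eval_fps (fps_deriv C) w
     + (\<alpha> * \<beta> * (w + t) - q) * eval_fps C w"
proof -
  have d1: "ereal (norm w) < fps_conv_radius (fps_deriv C)"
    using assms fps_conv_radius_deriv less_le_trans by blast
  have d2: "ereal (norm w) < fps_conv_radius (fps_deriv (fps_deriv C))"
    using d1 fps_conv_radius_deriv less_le_trans by blast
  have mult: "ereal (norm w) < fps_conv_radius (fps_of_poly p * D)"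
    if "ereal (norm w) < fps_conv_radius D" for p D
    using fps_conv_radius_mult[of "fps_of_poly p" D] that by (auto intro: less_le_trans)
  have add: "ereal (norm w) < fps_conv_radius (D + E)"
    if "ereal (norm w) < fps_conv_radius D" "ereal (norm w) < fps_conv_radius E" for D E
    using fps_conv_radius_add[of D E] that by (meson min_less_iff_conj less_le_trans)
  show ?thesis
    unfolding heun_op_def
    by (simp add: eval_fps_add eval_fps_mult add mult d1 d2 assms) (simp add: algebra_simps)
qed

text \<open>
  Away from the singularities one may clear denominators, and the resulting function is the sum of the
  series \<open>heun_op C\<close>. The function \<open>y\<close> is only required to agree with a power series on \<open>S\<close>, so that the
  result applies to the Frobenius solution, written with a complex power, and to polynomials in \<open>z\<close>.
\<close>

lemma heun_solution_on_eval_fps: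
  assumes "open S" "S \<inter> {0, 1, t} = {}"
    and rad: "\<And>z. z \<in> S \<Longrightarrow> ereal (norm (z - t)) < fps_conv_radius C"
    and y: "\<And>z. z \<in> S \<Longrightarrow> y z = eval_fps C (z - t)"
  shows "heun_solution_on \<alpha> \<beta> \<gamma> \<delta> \<epsilon> q t S y \<longleftrightarrow> (\<forall>z\<in>S. eval_fps (heun_op C) (z - t) = 0)"
proof -
  have 1: "(y has_field_derivative eval_fps (fps_deriv C) (z - t)) (at z)" if "z \<in> S" for z
    using deriv_eval_fps_shift[OF rad[OF that]] \<open>open S\<close> that
    by (rule has_field_derivative_transform_within_open) (simp add: y)
  have 2: "(deriv y has_field_derivative eval_fps (fps_deriv (fps_deriv C)) (z - t)) (at z)"
    if "z \<in> S" for z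
  proof -
    have "ereal (norm (z - t)) < fps_conv_radius (fps_deriv C)"
      using rad[OF that] fps_conv_radius_deriv less_le_trans by blast
    from deriv_eval_fps_shift[OF this] \<open>open S\<close> that show ?thesis
      by (rule has_field_derivative_transform_within_open) (simp add: DERIV_imp_deriv[OF 1])
  qed
  have hol: "y holomorphic_on S"
    using 1 \<open>open S\<close> by (auto simp: holomorphic_on_open)
  have "(deriv ^^ 2) y z
        + (\<gamma> / z + \<delta> / (z - 1) + \<epsilon> / (z - t)) * deriv y z
        + (\<alpha> * \<beta> * z - q) / (z * (z - 1) * (z - t)) * y z = 0 \<longleftrightarrow> eval_fps (heun_op C) (z - t) = 0"
    if z: "z \<in> S" for z
  proof -
    have nz: "z \<noteq> 0" "z - 1 \<noteq> 0" "z - t \<noteq> 0" using z assms(2) by auto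
    define a b c where "a = eval_fps (fps_deriv (fps_deriv C)) (z - t)"
      and "b = eval_fps (fps_deriv C) (z - t)" and "c = eval_fps C (z - t)"
    have "eval_fps (heun_op C) (z - t) =
       (z - t) * z * (z - 1) * a
       + (\<gamma> * (z - t) * (z - 1) + \<delta> * (z - t) * z + \<epsilon> * z * (z - 1)) * b
       + (\<alpha> * \<beta> * z - q) * c"
      by (simp add: eval_heun_op[OF rad[OF z]] a_def b_def c_def)
    also have "\<dots> = z * (z - 1) * (z - t) * (a + (\<gamma> / z + \<delta> / (z - 1) + \<epsilon> / (z - t)) * b
        + (\<alpha> * \<beta> * z - q) / (z * (z - 1) * (z - t)) * c)"
    proof -
      have "z * (z - 1) * (z - t) * (\<gamma> / z + \<delta> / (z - 1) + \<epsilon> / (z - t))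
          = \<gamma> * (z - t) * (z - 1) + \<delta> * (z - t) * z + \<epsilon> * z * (z - 1)"
        using nz by (simp add: distrib_left mult_ac)
      moreover have "z * (z - 1) * (z - t) * ((\<alpha> * \<beta> * z - q) / (z * (z - 1) * (z - t)))
          = \<alpha> * \<beta> * z - q"
        using nz by simp
      ultimately show ?thesis
        unfolding distrib_left mult.assoc[symmetric] by (simp add: mult_ac)
    qed
    finally show ?thesis
      using nz by (simp add: a_def b_def c_def y[OF z] DERIV_imp_deriv[OF 1[OF z]]
          DERIV_imp_deriv[OF 2[OF z]] numeral_2_eq_2)
  qed
  then show ?thesis using hol by (simp add: heun_solution_on_def)
qed

text \<open>
  The sum of \<open>heun_op C\<close> is holomorphic on the full ball, although the equation is known to hold only on
  a set accumulating at \<open>t\<close>; the identity theorem closes the gap.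
\<close>

lemma heun_op_eq_0_if_eval_eq_0:
  assumes "r > 0" "ereal r \<le> fps_conv_radius C" "S \<subseteq> ball t r" "t islimpt S"
    and "\<And>z. z \<in> S \<Longrightarrow> eval_fps (heun_op C) (z - t) = 0"
  shows "heun_op C = 0"
proof -
  have R: "ereal r \<le> fps_conv_radius (heun_op C)"
    using assms(2) conv_radius_heun_op order_trans by blast
  have *: "eval_fps (heun_op C) (z - t) = 0" if "z \<in> ball t r" for z
  proof (rule analytic_continuation[where f = "\<lambda>z. eval_fps (heun_op C) (z - t)"
        and w = z and U = S and S = "ball t r" and \<xi> = t])
    show "(\<lambda>z. eval_fps (heun_op C) (z - t)) holomorphic_on ball t r"
      unfolding holomorphic_on_open[OF open_ball]
    proof
      fix z assume "z \<in> ball t r"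
      then have "ereal (norm (z - t)) < fps_conv_radius (heun_op C)"
        by (auto simp: dist_norm norm_minus_commute intro!: less_le_trans[OF _ R])
      then show "\<exists>f'. ((\<lambda>z. eval_fps (heun_op C) (z - t)) has_field_derivative f') (at z)"
        using deriv_eval_fps_shift by blast
    qed
  qed (use assms that in auto)
  have "\<forall>\<^sub>F w in nhds 0. w \<in> ball (0 :: complex) r"
    using \<open>r > 0\<close> by (intro eventually_nhds_in_open) auto
  then have "\<forall>\<^sub>F w in nhds 0. eval_fps (heun_op C) w = eval_fps 0 w"
  proof (rule eventually_mono)
    fix w :: complex assume "w \<in> ball 0 r"
    then show "eval_fps (heun_op C) w = eval_fps 0 w"
      using *[of "w + t"] by (simp add: dist_norm)
  qed
  moreover have "fps_conv_radius (heun_op C) > 0"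
    using less_le_trans[OF _ R, of 0] \<open>r > 0\<close> by simp
  ultimately show ?thesis
    by (intro eval_fps_eqD) simp_all
qed

lemma slit_disc_facts:
  assumes "0 < r" "0 \<notin> ball t r" "1 \<notin> ball t r"
  shows "open (slit_disc t r)" "slit_disc t r \<inter> {0, 1, t} = {}" "slit_disc t r \<subseteq> ball t r"
    "t islimpt slit_disc t r"
proof -
  have "slit_disc t r = ball t r \<inter> (\<lambda>z. z - t) -` (- \<real>\<^sub>\<le>\<^sub>0)"
    by (auto simp: slit_disc_def)
  then show "open (slit_disc t r)"
    by (auto intro!: open_Int open_vimage continuous_intros)
  show "slit_disc t r \<inter> {0, 1, t} = {}" "slit_disc t r \<subseteq> ball t r"
    using assms by (auto simp: slit_disc_def)
  show "t islimpt slit_disc t r"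
    unfolding islimpt_approachable
  proof (intro allI impI)
    fix e :: real assume "e > 0"
    define d where "d = min e r / 2"
    have "d > 0" "d < e" "d < r" using \<open>e > 0\<close> \<open>0 < r\<close> by (auto simp: d_def)
    then show "\<exists>x\<in>slit_disc t r. x \<noteq> t \<and> dist x t < e"
      by (intro bexI[of _ "t + of_real d"]) (auto simp: slit_disc_def dist_norm complex_nonpos_Reals_iff)
  qed
qed

lemma heun_solution_on_slit_disc_iff:
  assumes r: "0 < r" "0 \<notin> ball t r" "1 \<notin> ball t r" "ereal r \<le> fps_conv_radius C"
    and y: "\<And>z. z \<in> slit_disc t r \<Longrightarrow> y z = eval_fps C (z - t)"
  shows "heun_solution_on \<alpha> \<beta> \<gamma> \<delta> \<epsilon> q t (slit_disc t r) y \<longleftrightarrow> heun_op C = 0"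
proof -
  note S = slit_disc_facts[OF r(1-3)]
  have "ereal (norm (z - t)) < fps_conv_radius C" if "z \<in> slit_disc t r" for z
    using r(4) S(3) that by (auto simp: dist_norm norm_minus_commute intro!: less_le_trans[OF _ r(4)])
  from heun_solution_on_eval_fps[OF S(1,2) this y]
  show ?thesis
    using heun_op_eq_0_if_eval_eq_0[OF r(1,4) S(3,4)] by auto
qed

lemma regular_radius:
  obtains r where "0 < r" "0 \<notin> ball t r" "1 \<notin> ball t r"
proof
  show "0 < min (norm t) (norm (t - 1))" using t0 t1 by simp
qed (auto simp: dist_norm)

text \<open>
  The polynomial on the right is the one on the left re-expanded at \<open>t\<close>.
\<close>

lemma has_poly_solution_iff:
  "heun_has_poly_solution \<alpha> \<beta> \<gamma> \<delta> \<epsilon> q t \<longleftrightarrow> (\<exists>p. p \<noteq> 0 \<and> heun_op (fps_of_poly p) = 0)"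
  (is "?L \<longleftrightarrow> ?R")
proof
  assume ?L
  then obtain p where p: "p \<noteq> 0" "heun_solution_on \<alpha> \<beta> \<gamma> \<delta> \<epsilon> q t (- {0, 1, t}) (poly p)"
    by (auto simp: heun_has_poly_solution_def)
  define s where "s = p \<circ>\<^sub>p [:t, 1:]"
  obtain r where r: "0 < r" "0 \<notin> ball t r" "1 \<notin> ball t r"
    by (rule regular_radius)
  have "slit_disc t r \<subseteq> - {0, 1, t}" using slit_disc_facts(2)[OF r] by blast
  then have "heun_solution_on \<alpha> \<beta> \<gamma> \<delta> \<epsilon> q t (slit_disc t r) (poly p)"
    using p(2) by (auto simp: heun_solution_on_def intro: holomorphic_on_subset)
  then have "heun_op (fps_of_poly s) = 0"
    using heun_solution_on_slit_disc_iff[OF r, of "fps_of_poly s" "poly p"]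
    by (simp add: s_def poly_pcompose)
  moreover have "s \<noteq> 0" using p(1) by (simp add: s_def pcompose_eq_0_iff)
  ultimately show ?R by blast
next
  assume ?R
  then obtain s where s: "s \<noteq> 0" "heun_op (fps_of_poly s) = 0" by blast
  let ?p = "s \<circ>\<^sub>p [:- t, 1:]"
  have "heun_solution_on \<alpha> \<beta> \<gamma> \<delta> \<epsilon> q t (- {0, 1, t}) (poly ?p)"
    by (subst heun_solution_on_eval_fps[where C = "fps_of_poly s"])
       (auto simp: s poly_pcompose intro!: open_Compl finite_imp_closed)
  moreover have "?p \<noteq> 0" using s(1) by (simp add: pcompose_eq_0_iff)
  ultimately show ?L by (auto simp: heun_has_poly_solution_def)
qed


section \<open>Apparent singularities and polynomial solutions\<close>

text \<open>
  The bound \<open>n \<le> m\<close> ensures that the polynomial does not vanish at \<open>t\<close>: otherwise all its coefficients up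
  to its degree \<open>n\<close> would vanish.
\<close>

theorem apparent_if_poly_solution:
  assumes \<alpha>: "\<alpha> = - of_nat n" and \<beta>: "\<beta> \<notin> \<int>\<^sub>\<le>\<^sub>0" and "n \<le> m"
    and "heun_has_poly_solution \<alpha> \<beta> \<gamma> \<delta> \<epsilon> q t"
  shows "heun_apparent \<alpha> \<beta> \<gamma> \<delta> \<epsilon> q t"
proof -
  obtain p where p: "p \<noteq> 0" "heun_op (fps_of_poly p) = 0"
    using assms(4) has_poly_solution_iff by blast
  have deg: "degree p = n" using degree_poly_kernel[OF p(2,1) \<alpha> \<beta>] .
  have p0: "coeff p 0 \<noteq> 0"
  proof
    assume "coeff p 0 = 0"
    then have "coeff p (degree p) = 0"
      using heun_op_vanishing[OF p(2), of "degree p"] deg \<open>n \<le> m\<close> by simp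
    then show False using p(1) by simp
  qed
  obtain G where G: "fps_nth G 0 = 1" "fps_conv_radius G > 0" "heun_op (fps_X ^ (m + 1) * G) = 0"
    by (rule frobenius_solution)
  obtain R :: real where R: "0 < R" "ereal R < fps_conv_radius G"
    using ereal_dense2[OF G(2)] by auto
  obtain r' where r': "0 < r'" "0 \<notin> ball t r'" "1 \<notin> ball t r'"
    by (rule regular_radius)
  define r where "r = min R r'"
  have r: "0 < r" "0 \<notin> ball t r" "1 \<notin> ball t r"
    using R r' by (auto simp: r_def)
  have rG: "ereal r \<le> fps_conv_radius G"
  proof -
    have "ereal r \<le> ereal R" by (simp add: r_def)
    then show ?thesis using R by (meson order_trans less_imp_le)
  qed
  have XG: "ereal r \<le> fps_conv_radius (fps_X ^ (m + 1) * G)"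
    using fps_conv_radius_mult[of "fps_X ^ (m + 1)" G] rG
    by (simp del: power_Suc add: order_trans)
  have g: "(z - t) powr (1 - \<epsilon>) * eval_fps G (z - t) = eval_fps (fps_X ^ (m + 1) * G) (z - t)"
    if "z \<in> slit_disc t r" for z
  proof -
    have "z \<noteq> t" using slit_disc_facts(2)[OF r] that by auto
    \<comment> \<open>The exponent is the positive integer \<open>m + 1\<close>, so the complex power is an ordinary one.\<close>
    then have "(z - t) powr (1 - \<epsilon>) = (z - t) ^ (m + 1)"
      using powr_nat'[of "z - t" "m + 1"] by (simp add: eps add.commute)
    moreover have "ereal (norm (z - t)) < fps_conv_radius G"
      using slit_disc_facts(3)[OF r] that
      by (auto simp: dist_norm norm_minus_commute intro!: less_le_trans[OF _ rG])
    ultimately show ?thesis by (simp del: power_Suc add: eval_fps_mult)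
  qed
  have "heun_local_basis \<alpha> \<beta> \<gamma> \<delta> \<epsilon> q t (fps_of_poly p) G 0"
    unfolding heun_local_basis_def Let_def
  proof (intro conjI exI[of _ r])
    show "heun_solution_on \<alpha> \<beta> \<gamma> \<delta> \<epsilon> q t (slit_disc t r)
            (\<lambda>z. (z - t) powr (1 - \<epsilon>) * eval_fps G (z - t))"
      using heun_solution_on_slit_disc_iff[OF r XG g] G(3) by simp
    show "heun_solution_on \<alpha> \<beta> \<gamma> \<delta> \<epsilon> q t (slit_disc t r)
            (\<lambda>z. eval_fps (fps_of_poly p) (z - t)
               + 0 * ((z - t) powr (1 - \<epsilon>) * eval_fps G (z - t)) * Ln (z - t))"
      using heun_solution_on_slit_disc_iff[OF r, of "fps_of_poly p"] p(2) by simp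
  qed (use r rG p0 G in auto)
  then show ?thesis by (auto simp: heun_apparent_def)
qed

text \<open>
  Two power series solutions that differ in their order at \<open>t\<close> span a plane, and \<open>c (n+1) = 0\<close> is a single
  linear condition on that plane.
\<close>

theorem poly_solution_if_apparent:
  assumes \<alpha>: "\<alpha> = - of_nat n" and "m \<le> n"
    and "heun_apparent \<alpha> \<beta> \<gamma> \<delta> \<epsilon> q t"
  shows "heun_has_poly_solution \<alpha> \<beta> \<gamma> \<delta> \<epsilon> q t"
proof -
  obtain F G r where F0: "fps_nth F 0 \<noteq> 0" and r: "0 < r" "0 \<notin> ball t r" "1 \<notin> ball t r"
    and rF: "ereal r \<le> fps_conv_radius F"
    and f: "heun_solution_on \<alpha> \<beta> \<gamma> \<delta> \<epsilon> q t (slit_disc t r)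
            (\<lambda>z. eval_fps F (z - t)
               + 0 * ((z - t) powr (1 - \<epsilon>) * eval_fps G (z - t)) * Ln (z - t))"
    using assms(3) unfolding heun_apparent_def heun_local_basis_def Let_def by blast
  have F: "heun_op F = 0"
    using f heun_solution_on_slit_disc_iff[OF r rF] by simp
  obtain G where G: "fps_nth G 0 = 1" "heun_op (fps_X ^ (m + 1) * G) = 0"
    by (rule frobenius_solution)
  define H where "H = fps_X ^ (m + 1) * G"
  have H: "heun_op H = 0" "fps_nth H 0 = 0" "H \<noteq> 0"
    using G by (auto simp: H_def)
  have "\<exists>C. C \<noteq> 0 \<and> heun_op C = 0 \<and> fps_nth C (Suc n) = 0"
  proof (cases "fps_nth H (Suc n) = 0")
    case True
    then show ?thesis using H by blast
  next
    case False
    \<comment> \<open>\<open>H\<close> has no constant term, so adding a multiple of it keeps \<open>F\<close> from vanishing.\<close>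
    define C where "C = F + fps_const (- fps_nth F (Suc n) / fps_nth H (Suc n)) * H"
    have "heun_op C = 0" by (simp add: C_def heun_op_linear F H)
    moreover have "fps_nth C (Suc n) = 0" using False by (simp add: C_def)
    moreover have "fps_nth C 0 = fps_nth F 0" by (simp add: C_def H)
    then have "C \<noteq> 0" using F0 by auto
    ultimately show ?thesis by blast
  qed
  then obtain C where C: "C \<noteq> 0" "heun_op C = 0" "fps_nth C (Suc n) = 0" by blast
  define p where "p = (\<Sum>k\<le>n. monom (fps_nth C k) k)"
  have "fps_of_poly p = C"
  proof (rule fps_ext)
    fix k
    show "fps_nth (fps_of_poly p) k = fps_nth C k"
      using heun_op_termination[OF C(2) \<alpha> \<open>m \<le> n\<close> C(3), of k]
      by (auto simp: p_def coeff_sum)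
  qed
  moreover have "p \<noteq> 0" using calculation C(1) by auto
  ultimately show ?thesis using C(2) has_poly_solution_iff by blast
qed

end

theorem theorem5p3:
  fixes \<alpha> \<beta> \<gamma> \<delta> \<epsilon> q t :: complex
  assumes "\<gamma> + \<delta> + \<epsilon> = \<alpha> + \<beta> + 1"
    and "t \<noteq> 0" and "t \<noteq> 1"
    and "\<epsilon> \<in> \<int>\<^sub>\<le>\<^sub>0" and "\<alpha> \<in> \<int>\<^sub>\<le>\<^sub>0" and "\<beta> \<notin> \<int>\<^sub>\<le>\<^sub>0"
  shows "(Re (- \<alpha>) \<le> Re (- \<epsilon>) \<and> heun_has_poly_solution \<alpha> \<beta> \<gamma> \<delta> \<epsilon> q t
            \<longrightarrow> heun_apparent \<alpha> \<beta> \<gamma> \<delta> \<epsilon> q t) \<and>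
         (Re (- \<epsilon>) \<le> Re (- \<alpha>) \<and> heun_apparent \<alpha> \<beta> \<gamma> \<delta> \<epsilon> q t
            \<longrightarrow> heun_has_poly_solution \<alpha> \<beta> \<gamma> \<delta> \<epsilon> q t)"
proof -
  obtain m where m: "\<epsilon> = - of_nat m" using assms(4) by (elim nonpos_Ints_cases')
  obtain n where n: "\<alpha> = - of_nat n" using assms(5) by (elim nonpos_Ints_cases')
  interpret heun \<alpha> \<beta> \<gamma> \<delta> \<epsilon> q t m
    using assms m by unfold_locales
  show ?thesis
    using apparent_if_poly_solution[OF n assms(6)] poly_solution_if_apparent[OF n] m n by auto
qed

end
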